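(* Let $X$ and $Y$ be finite-dimensional real inner product spaces, let $\mathsf{K}_h : X \to Y$ be a linear operator with a nontrivial nullspace $\mathcal{N}(\mathsf{K}_h)$, and let $\mathsf{P}: X \to \mathcal{N}(\mathsf{K}_h)^{\perp}$ denote the orthogonal projection of elements of $X$ onto the orthogonal complement of the nullspace of $\mathsf{K}_h$. Let $\mathcal{B} = \{\phi_1, \phi_2, \ldots, \phi_n\}$ be an orthonormal basis of $X$ such that $\|\mathsf{P}\phi_i\|_X \neq 0$ for $i = 1, 2, \ldots, n$, and let $\mathsf{W}: X \to X$ be the linear operator defined by $$\mathsf{W}\phi_i = \|\mathsf{P}\phi_i\|_X\, \phi_i, \quad i = 1, 2, \ldots, n.$$ Then, for any $j \in \{1, 2, \ldots, n\}$, the minimum norm least-squares solution $\mathbf{x}_j^*$ of $$\mathsf{K}_h \mathbf{x} = \mathsf{K}_h \phi_j$$ satisfies $$\mathsf{W}^{-1} \mathbf{x}_j^* = \|\mathsf{P}\phi_j\|_X \sum_{i=1}^{n} \left( \frac{\mathsf{P}\phi_j}{\|\mathsf{P}\phi_j\|_X}, \frac{\mathsf{P}\phi_i}{\|\mathsf{P}\phi_i\|_X} \right)_X \phi_i.$$ Hence, $$j \in \operatorname*{arg\,max}_{i \in \{1, 2, \ldots, n\}} \left( \mathsf{W}^{-1}\mathbf{x}_j^*(i) \right),$$ where $\mathsf{W}^{-1}\mathbf{x}_j^*(i)$ denotes the $i$-th component of the coordinate vector $[\mathsf{W}^{-1}\mathbf{x}_j^*]_{\mathcal{B}} \in \mathbb{R}^n$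 of $\mathsf{W}^{-1}\mathbf{x}_j^*$ with respect to the basis $\mathcal{B}$.
   Context: $(\cdot,\cdot)_X$ and $\|\cdot\|_X$ denote the inner product and induced norm of $X$, and similarly for $Y$. The minimum norm least-squares solution of $\mathsf{K}_h\mathbf{x} = \mathbf{b}$ is the element of smallest $X$-norm among all minimizers of $\|\mathsf{K}_h \mathbf{x} - \mathbf{b}\|_Y$, i.e. $\mathsf{K}_h^{\dagger}\mathbf{b}$, where $\mathsf{K}_h^\dagger$ is the Moore-Penrose inverse. *)

theory Defs
  imports "HOL-Analysis.Analysis"
begin

definition nullspace :: "('a::real_vector \<Rightarrow> 'b::real_vector) \<Rightarrow> 'a set" where
  "nullspace K = {x. K x = 0}"

definition orth_proj :: "'a::euclidean_space set \<Rightarrow> 'a \<Rightarrow> 'a" where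
  "orth_proj S x = (THE p. p \<in> S \<and> x - p \<in> S\<^sup>\<bottom>)"

definition orthonormal_basis :: "nat \<Rightarrow> (nat \<Rightarrow> 'a::euclidean_space) \<Rightarrow> bool" where
  "orthonormal_basis n \<phi> \<longleftrightarrow>
     (\<forall>i\<in>{1..n}. \<forall>j\<in>{1..n}. \<phi> i \<bullet> \<phi> j = (if i = j then 1 else 0)) \<and>
     span (\<phi> ` {1..n}) = UNIV"

definition least_squares_sol ::
    "('a::real_normed_vector \<Rightarrow> 'b::real_normed_vector) \<Rightarrow> 'b \<Rightarrow> 'a \<Rightarrow> bool" where
  "least_squares_sol K b x \<longleftrightarrow> (\<forall>z. norm (K x - b) \<le> norm (K z - b))"

definition min_norm_lsq ::
    "('a::real_normed_vector \<Rightarrow> 'b::real_normed_vector) \<Rightarrow> 'b \<Rightarrow> 'a" where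
  "min_norm_lsq K b =
     (THE x. least_squares_sol K b x \<and> (\<forall>z. least_squares_sol K b z \<longrightarrow> norm x \<le> norm z))"

text \<open>The two definite descriptions above are proper: the orthogonal projection onto a subspace
  and the minimum norm least-squares solution exist and are unique.\<close>

lemma orth_proj_ex1:
  fixes S :: "'a::euclidean_space set"
  assumes "subspace S"
  shows "\<exists>!p. p \<in> S \<and> x - p \<in> S\<^sup>\<bottom>"
proof -
  obtain y z where yz: "y \<in> span S" "\<And>w. w \<in> span S \<Longrightarrow> orthogonal z w" "x = y + z"
    using orthogonal_subspace_decomp_exists[of S x] by metis
  have S: "span S = S"
    using assms by (simp add: span_eq_iff)
  have "z \<in> S\<^sup>\<bottom>"
    unfolding orthogonal_comp_def using yz(2) orthogonal_commute S by blast
  then have y: "y \<in> S \<and> x - y \<in> S\<^sup>\<bottom>"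
    using yz(1) unfolding S yz(3) by simp
  moreover have "p = y" if p: "p \<in> S \<and> x - p \<in> S\<^sup>\<bottom>" for p
  proof -
    have "p - y \<in> S"
      using p y assms by (simp add: subspace_diff)
    moreover have "p - y \<in> S\<^sup>\<bottom>"
    proof -
      have "(x - y) - (x - p) \<in> S\<^sup>\<bottom>"
        using p y by (blast intro: subspace_diff[OF subspace_orthogonal_comp])
      then show ?thesis by simp
    qed
    ultimately have "(p - y) \<bullet> (p - y) = 0"
      unfolding orthogonal_comp_def orthogonal_def by blast
    then show ?thesis by simp
  qed
  ultimately show ?thesis by blast
qed

lemma min_norm_lsq_ex1:
  fixes K :: "'a::euclidean_space \<Rightarrow> 'b::euclidean_space"
  assumes "linear K"
  shows "\<exists>!x. least_squares_sol K b x \<and> (\<forall>z. least_squares_sol K b z \<longrightarrow> norm x \<le> norm z)"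
proof -
  have R: "closed (range K)" "convex (range K)"
    using assms by (simp_all add: closed_subspace linear_subspace_image subspace_imp_convex)
  define y where "y = closest_point (range K) b"
  have yR: "y \<in> range K"
    unfolding y_def using closest_point_in_set[OF R(1), of b] by simp
  have yle: "norm (y - b) \<le> norm (K z - b)" for z
    unfolding y_def using closest_point_le[OF R(1), of "K z" b] by (simp add: dist_norm norm_minus_commute)
  have iff: "least_squares_sol K b x \<longleftrightarrow> K x = y" for x
  proof (rule iffI)
    assume "least_squares_sol K b x"
    then have "\<forall>z\<in>range K. dist b (K x) \<le> dist b z"
      by (auto simp: least_squares_sol_def dist_norm norm_minus_commute)
    then show "K x = y"
      unfolding y_def by (intro closest_point_unique[OF R(2,1)]) auto
  next
    assume "K x = y"
    then show "least_squares_sol K b x"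
      using yle by (simp add: least_squares_sol_def)
  qed
  define L where "L = K -` {y}"
  have "continuous_on UNIV K"
    using assms by (simp add: linear_continuous_on linear_conv_bounded_linear)
  then have L1: "closed L"
    unfolding L_def by (rule closed_vimage[OF closed_singleton])
  have L2: "convex L"
    unfolding L_def using assms by (rule convex_linear_vimage) simp
  have L3: "L \<noteq> {}"
    using yR unfolding L_def by blast
  have "closest_point L 0 \<in> L \<and> (\<forall>z\<in>L. dist 0 (closest_point L 0) \<le> dist 0 z)"
    using closest_point_exists[OF L1 L3, of 0] by simp
  moreover have "x = closest_point L 0" if "x \<in> L \<and> (\<forall>z\<in>L. dist 0 x \<le> dist 0 z)" for x
    using that by (intro closest_point_unique[OF L2 L1]) auto
  ultimately have "\<exists>!x. x \<in> L \<and> (\<forall>z\<in>L. dist 0 x \<le> dist 0 z)"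
    by (rule ex1I)
  then show ?thesis
    by (simp only: iff L_def Ball_def vimage_eq singleton_iff dist_0_norm)
qed

end

theory Submission
  imports Defs
begin

text \<open>The least-squares solutions of \<open>K x = K v\<close> form the coset of the nullspace through \<open>v\<close>, whose
  element of least norm is \<open>P v\<close>. Since \<open>P\<close> is symmetric and idempotent, the \<open>i\<close>-th coordinate
  of \<open>P \<phi>\<^sub>j\<close> is \<open>(P \<phi>\<^sub>j, P \<phi>\<^sub>i)\<close>; dividing it by the eigenvalue \<open>\<parallel>P \<phi>\<^sub>i\<parallel>\<close> of \<open>W\<close> gives
  \<open>\<parallel>P \<phi>\<^sub>j\<parallel>\<close> times a cosine, which by Cauchy-Schwarz is largest at \<open>i = j\<close>.\<close>

lemma subspace_nullspace: "linear K \<Longrightarrow> subspace (nullspace K)"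
  unfolding nullspace_def by (rule linear_subspace_kernel)

lemma orth_proj_in: "subspace S \<Longrightarrow> orth_proj S x \<in> S"
  and diff_orth_proj_in: "subspace S \<Longrightarrow> x - orth_proj S x \<in> S\<^sup>\<bottom>"
  using theI'[OF orth_proj_ex1[of S x]] by (auto simp: orth_proj_def)

text \<open>The residual \<open>y - orth_proj S y\<close> lies in the complement of \<open>S\<close>
  and is thus orthogonal to \<open>orth_proj S x\<close>. This one identity packages symmetry and
  idempotence of the projection.\<close>

lemma inner_orth_proj:
  assumes "subspace S"
  shows "orth_proj S x \<bullet> y = orth_proj S x \<bullet> orth_proj S y"
proof -
  have "orth_proj S x \<bullet> (y - orth_proj S y) = 0"
    using orth_proj_in[OF assms, of x] diff_orth_proj_in[OF assms, of y]
    by (auto simp: orthogonal_comp_def orthogonal_def)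
  then show ?thesis
    by (simp add: inner_diff_right)
qed

lemma min_norm_lsq_image:
  fixes K :: "'a::euclidean_space \<Rightarrow> 'b::euclidean_space"
  assumes "linear K"
  shows "min_norm_lsq K (K v) = orth_proj ((nullspace K)\<^sup>\<bottom>) v"
proof -
  define p where "p = orth_proj ((nullspace K)\<^sup>\<bottom>) v"
  have p: "p \<in> (nullspace K)\<^sup>\<bottom>"
    unfolding p_def by (rule orth_proj_in[OF subspace_orthogonal_comp])
  \<comment> \<open>The residual lies in the double complement of the nullspace, which is the
    nullspace itself.\<close>
  have "v - p \<in> nullspace K"
    using diff_orth_proj_in[OF subspace_orthogonal_comp, of v "nullspace K"]
    by (simp add: p_def orthogonal_comp_self subspace_nullspace[OF assms])
  then have Kp: "K p = K v"
    by (simp add: nullspace_def linear_diff[OF assms])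
  \<comment> \<open>The right-hand side is attained at \<open>v\<close>, so the least residual is 0
    and every minimizer solves the equation exactly.\<close>
  have lsq: "least_squares_sol K (K v) z \<longleftrightarrow> K z = K v" for z
    by (auto simp: least_squares_sol_def dest: spec[of _ v])
  have "norm p \<le> norm z" if "K z = K v" for z
  proof -
    have "z - p \<in> nullspace K"
      using that Kp by (simp add: nullspace_def linear_diff[OF assms])
    then have "orthogonal p (z - p)"
      using p unfolding orthogonal_comp_def orthogonal_commute[of p] by blast
    then have "(norm z)\<^sup>2 = (norm p)\<^sup>2 + (norm (z - p))\<^sup>2"
      using norm_add_Pythagorean[of p "z - p"] by simp
    then show ?thesis
      by (simp add: power2_le_imp_le)
  qed
  then show ?thesis
    unfolding min_norm_lsq_def p_def[symmetric]
    using Kp by (intro the1_equality[OF min_norm_lsq_ex1[OF assms]]) (simp add: lsq)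
qed

context
  fixes n :: nat and \<phi> :: "nat \<Rightarrow> 'a::euclidean_space"
  assumes basis: "orthonormal_basis n \<phi>"
begin

lemma orthonormal_basis_inner:
  "i \<in> {1..n} \<Longrightarrow> j \<in> {1..n} \<Longrightarrow> \<phi> i \<bullet> \<phi> j = (if i = j then 1 else 0)"
  using basis by (simp add: orthonormal_basis_def)

lemma orthonormal_basis_inner_sum:
  assumes "i \<in> {1..n}"
  shows "(\<Sum>k=1..n. c k *\<^sub>R \<phi> k) \<bullet> \<phi> i = c i"
proof -
  have "(\<Sum>k=1..n. c k *\<^sub>R \<phi> k) \<bullet> \<phi> i = (\<Sum>k=1..n. if k = i then c k else 0)"
    unfolding inner_sum_left
    using orthonormal_basis_inner[OF _ assms] by (intro sum.cong) simp_all
  then show ?thesis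
    using assms by simp
qed

text \<open>The difference \<open>x - y\<close> is orthogonal to a spanning set, hence to
  itself.\<close>

lemma orthonormal_basis_eqI:
  assumes "\<And>i. i \<in> {1..n} \<Longrightarrow> x \<bullet> \<phi> i = y \<bullet> \<phi> i"
  shows "x = y"
proof -
  have "orthogonal (x - y) z" if "z \<in> span (\<phi> ` {1..n})" for z
    by (rule orthogonal_to_span[OF that]) (auto simp: orthogonal_def inner_diff_left assms)
  then have "orthogonal (x - y) (x - y)"
    using basis by (simp add: orthonormal_basis_def)
  then show ?thesis
    by (simp add: orthogonal_def)
qed

lemma orthonormal_basis_expansion: "x = (\<Sum>i=1..n. (x \<bullet> \<phi> i) *\<^sub>R \<phi> i)"
  by (rule orthonormal_basis_eqI) (simp only: orthonormal_basis_inner_sum)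

lemma inj_on_orthonormal_basis: "inj_on \<phi> {1..n}"
  using orthonormal_basis_inner by (metis inj_onI zero_neq_one)

lemma independent_orthonormal_basis: "independent (\<phi> ` {1..n})"
proof (rule pairwise_orthogonal_independent)
  show "pairwise orthogonal (\<phi> ` {1..n})"
    by (auto simp: pairwise_def orthogonal_def orthonormal_basis_inner)
  show "0 \<notin> \<phi> ` {1..n}"
    using orthonormal_basis_inner by (metis imageE inner_zero_left zero_neq_one)
qed

text \<open>Links the coordinates in the argmax claim to inner products. Since
  \<open>representation\<close> is indexed by basis vectors, injectivity of \<open>\<phi>\<close> is
  what turns its expansion into a sum over indices.\<close>

lemma representation_orthonormal_basis:
  assumes "i \<in> {1..n}"
  shows "representation (\<phi> ` {1..n}) x (\<phi> i) = x \<bullet> \<phi> i"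
proof -
  have "x = (\<Sum>b\<in>\<phi> ` {1..n}. representation (\<phi> ` {1..n}) x b *\<^sub>R b)"
    using basis
    by (intro real_vector.sum_representation_eq[symmetric] independent_orthonormal_basis)
      (auto simp: orthonormal_basis_def)
  also have "\<dots> = (\<Sum>k=1..n. representation (\<phi> ` {1..n}) x (\<phi> k) *\<^sub>R \<phi> k)"
    by (simp only: sum.reindex[OF inj_on_orthonormal_basis] o_def)
  finally show ?thesis
    using orthonormal_basis_inner_sum[OF assms, of "\<lambda>k. representation (\<phi> ` {1..n}) x (\<phi> k)"]
    by simp
qed

lemma diagonal_apply:
  fixes d :: "nat \<Rightarrow> real"
  assumes "linear W" "\<forall>i\<in>{1..n}. W (\<phi> i) = d i *\<^sub>R \<phi> i"
  shows "W (\<Sum>i=1..n. c i *\<^sub>R \<phi> i) = (\<Sum>i=1..n. (c i * d i) *\<^sub>R \<phi> i)"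
  using assms(2) by (simp add: linear_sum[OF assms(1)] linear_cmul[OF assms(1)])

text \<open>An explicit preimage of \<open>x\<close>, used both for surjectivity of \<open>W\<close>
  and for the formula for \<open>inv W\<close>.\<close>

lemma diagonal_divide:
  fixes d :: "nat \<Rightarrow> real"
  assumes "linear W" "\<forall>i\<in>{1..n}. W (\<phi> i) = d i *\<^sub>R \<phi> i" "\<forall>i\<in>{1..n}. d i \<noteq> 0"
  shows "W (\<Sum>i=1..n. (x \<bullet> \<phi> i / d i) *\<^sub>R \<phi> i) = x"
proof -
  have "(\<Sum>i=1..n. (x \<bullet> \<phi> i / d i * d i) *\<^sub>R \<phi> i) = (\<Sum>i=1..n. (x \<bullet> \<phi> i) *\<^sub>R \<phi> i)"
    using assms(3) by (intro sum.cong) auto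
  then show ?thesis
    unfolding diagonal_apply[OF assms(1,2)] using orthonormal_basis_expansion[of x] by simp
qed

text \<open>In finite dimension a surjective linear endomorphism is injective. Bijectivity makes
  \<open>inv W\<close> a genuine two-sided inverse rather than a choice of preimages.\<close>

lemma bij_diagonal:
  fixes d :: "nat \<Rightarrow> real"
  assumes "linear W" "\<forall>i\<in>{1..n}. W (\<phi> i) = d i *\<^sub>R \<phi> i" "\<forall>i\<in>{1..n}. d i \<noteq> 0"
  shows "bij W"
proof -
  have "surj W"
    by (rule surjI) (rule diagonal_divide[OF assms])
  then show ?thesis
    using linear_surjective_imp_injective[OF assms(1)] by (simp add: bij_def)
qed

lemma inv_diagonal:
  fixes d :: "nat \<Rightarrow> real"
  assumes "linear W" "\<forall>i\<in>{1..n}. W (\<phi> i) = d i *\<^sub>R \<phi> i" "\<forall>i\<in>{1..n}. d i \<noteq> 0"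
  shows "inv W x = (\<Sum>i=1..n. (x \<bullet> \<phi> i / d i) *\<^sub>R \<phi> i)"
  by (rule inv_f_eq[OF bij_is_inj[OF bij_diagonal[OF assms]] diagonal_divide[OF assms]])

end

theorem theorem4p2:
  fixes K :: "'a::euclidean_space \<Rightarrow> 'b::euclidean_space"
    and P W :: "'a \<Rightarrow> 'a"
    and \<phi> :: "nat \<Rightarrow> 'a"
    and n :: nat
  assumes "linear K"
    and "nullspace K \<noteq> {0}"
    and "P = orth_proj ((nullspace K)\<^sup>\<bottom>)"
    and "orthonormal_basis n \<phi>"
    and "\<forall>i\<in>{1..n}. norm (P (\<phi> i)) \<noteq> 0"
    and "linear W"
    and "\<forall>i\<in>{1..n}. W (\<phi> i) = norm (P (\<phi> i)) *\<^sub>R \<phi> i"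
  shows "bij W \<and>
    (\<forall>j\<in>{1..n}. \<forall>x. x = min_norm_lsq K (K (\<phi> j)) \<longrightarrow>
      inv W x = norm (P (\<phi> j)) *\<^sub>R
        (\<Sum>i=1..n. ((P (\<phi> j) /\<^sub>R norm (P (\<phi> j))) \<bullet> (P (\<phi> i) /\<^sub>R norm (P (\<phi> i)))) *\<^sub>R \<phi> i) \<and>
      is_arg_max (\<lambda>i. representation (\<phi> ` {1..n}) (inv W x) (\<phi> i)) (\<lambda>i. i \<in> {1..n}) j)"
proof (intro conjI ballI allI impI)
  have P_inner: "P x \<bullet> y = P x \<bullet> P y" for x y
    unfolding assms(3) by (rule inner_orth_proj[OF subspace_orthogonal_comp])
  show "bij W"
    by (rule bij_diagonal[OF assms(4,6,7,5)])
  fix j x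
  assume j: "j \<in> {1..n}" and x: "x = min_norm_lsq K (K (\<phi> j))"
  let ?u = "\<lambda>i. P (\<phi> i) /\<^sub>R norm (P (\<phi> i))"
  have x: "x = P (\<phi> j)"
    unfolding x assms(3) by (rule min_norm_lsq_image[OF assms(1)])
  \<comment> \<open>The factor \<open>norm (P (\<phi> j))\<close> cancels the normalization of
    \<open>?u j\<close>. If \<open>P (\<phi> i) = 0\<close> for some \<open>i\<close> outside the
    range, both sides are 0 because division by zero yields 0; so the equation can rewrite under the
    sum.\<close>
  have coeff: "x \<bullet> \<phi> i / norm (P (\<phi> i)) = norm (P (\<phi> j)) * (?u j \<bullet> ?u i)" for i
    using assms(5) j P_inner[of "\<phi> j" "\<phi> i"] by (simp add: x divide_inverse)
  show inv: "inv W x = norm (P (\<phi> j)) *\<^sub>R (\<Sum>i=1..n. (?u j \<bullet> ?u i) *\<^sub>R \<phi> i)"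
    unfolding inv_diagonal[OF assms(4,6,7,5)] coeff by (simp add: scaleR_sum_right)
  have rep: "representation (\<phi> ` {1..n}) (inv W x) (\<phi> i) = norm (P (\<phi> j)) * (?u j \<bullet> ?u i)"
    if "i \<in> {1..n}" for i
    unfolding representation_orthonormal_basis[OF assms(4) that] inv inner_scaleR_left[of "norm _"]
      orthonormal_basis_inner_sum[OF assms(4) that] ..
  have unit: "norm (?u i) = 1" if "i \<in> {1..n}" for i
    using assms(5) that by simp
  \<comment> \<open>Both vectors are units, so the Cauchy-Schwarz bound is 1, which is
    \<open>?u j \<bullet> ?u j\<close>.\<close>
  have max: "?u j \<bullet> ?u i \<le> ?u j \<bullet> ?u j" if "i \<in> {1..n}" for i
    using norm_cauchy_schwarz[of "?u j" "?u i"]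
    unfolding power2_norm_eq_inner[symmetric, of "?u j"] unit[OF j] unit[OF that] by simp
  show "is_arg_max (\<lambda>i. representation (\<phi> ` {1..n}) (inv W x) (\<phi> i)) (\<lambda>i. i \<in> {1..n}) j"
    unfolding is_arg_max_linorder
  proof (intro conjI allI impI j)
    fix i
    assume i: "i \<in> {1..n}"
    show "representation (\<phi> ` {1..n}) (inv W x) (\<phi> i)
        \<le> representation (\<phi> ` {1..n}) (inv W x) (\<phi> j)"
      unfolding rep[OF i] rep[OF j] using max[OF i] norm_ge_zero by (rule mult_left_mono)
  qed
qed

end
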